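(* Let $f:I\subset\mathbb{R}\to\mathbb{R}$ be a twice differentiable function on $I^{\circ}$ such that $f''\in L_1[a,b]$, where $a,b\in I$, $a<b$. Let $\alpha,\beta$ be real numbers with $a\le\alpha<\beta\le b$. If $f'$ is convex on $[a,b]$ and $f''(t)\ge 0$ for $t\in[a,b]$, then for any $x\in[a,\frac{a+b}{2}]$, $$\begin{aligned} \Big| & 2\int_a^b f(t)\,dt-(\beta-\alpha)\left[f(x)+f(a+b-x)\right]\\ &+(b-\beta)^2f'(b)-(a-\alpha)^2f'(a)+2(a-\alpha)f(a)-2(b-\beta)f(b)\\ &+(\beta-\alpha)\left[\left(x-\tfrac{3\alpha+\beta}{4}\right)f'(x)+\left(a+b-x-\tfrac{\alpha+3\beta}{4}\right)f'(a+b-x)\right]\Big|\\ &\le \|k\|_\infty\left[f'(b)-f'(a)\right], \end{aligned}$$ where $\|k\|_\infty=\max_{t\in[a,b]}|k(a,b,t)|$ and $k(a,b,t)$ is the kernel (depending on $x,\alpha,\beta$) defined in the context.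
   Context: $I$ is an interval of real numbers and $I^{\circ}$ is its interior. For $a\le\alpha<\beta\le b$ and $x\in[a,\frac{a+b}{2}]$, the kernel is $$k(a,b,t)=\begin{cases}(t-\alpha)^2, & a\le t<x,\\ \left(t-\frac{\alpha+\beta}{2}\right)^2, & x\le t<a+b-x,\\ (t-\beta)^2, & a+b-x\le t\le b.\end{cases}$$ *)

theory Defs
  imports "HOL-Analysis.Analysis"
begin

definition kernel :: "real \<Rightarrow> real \<Rightarrow> real \<Rightarrow> real \<Rightarrow> real \<Rightarrow> real \<Rightarrow> real" where
  "kernel \<alpha> \<beta> x a b t =
     (if t < x then (t - \<alpha>)\<^sup>2
      else if t < a + b - x then (t - (\<alpha> + \<beta>) / 2)\<^sup>2
      else (t - \<beta>)\<^sup>2)"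

text \<open>
  The norm is a supremum rather than a maximum: the kernel may jump at \<open>x\<close> and at
  \<open>a + b - x\<close>, and then the largest value need not be attained. For \<open>a = \<alpha> = 0\<close>,
  \<open>b = 1\<close>, \<open>\<beta> = 4/5\<close> and \<open>x = 1/2\<close> the supremum \<open>1/4\<close> is only approached as \<open>t\<close>
  tends to \<open>1/2\<close> from the left. If the maximum exists, it is this supremum.
\<close>

definition kernel_norm :: "real \<Rightarrow> real \<Rightarrow> real \<Rightarrow> real \<Rightarrow> real \<Rightarrow> real" where
  "kernel_norm \<alpha> \<beta> x a b = (SUP t\<in>{a..b}. \<bar>kernel \<alpha> \<beta> x a b t\<bar>)"

end

theory Submission
  imports Defs
begin

text \<open>
  With \<open>F\<close> an antiderivative of \<open>f\<close>, the function
  \<open>G\<^sub>c t = (t - c)\<^sup>2 f' t - 2 (t - c) f t + 2 F t\<close> has derivative \<open>(t - c)\<^sup>2 f'' t\<close>.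
  Hence on each of the three pieces of the kernel both \<open>G\<^sub>c\<close> and \<open>K f' - G\<^sub>c\<close> are
  nondecreasing, where \<open>K\<close> is the norm of the kernel and \<open>c\<close> the centre of the piece. The
  increments of \<open>G\<^sub>c\<close> over the pieces add up to the left-hand side, those of \<open>K f'\<close> to the
  right-hand side. At \<open>a\<close> and \<open>b\<close> this needs \<open>f'\<close> to be continuous, which
  holds because \<open>f'\<close> is a monotone derivative.
\<close>

text \<open>By the mean value theorem and monotonicity, \<open>f' t\<close> lies between the slope
  of \<open>f\<close> over \<open>[a, t]\<close> and its slope over the adjacent interval
  \<open>[t, 2 * t - a]\<close> of equal length. Both slopes are combinations of the difference
  quotient \<open>q\<close> at \<open>a\<close>, so both tend to \<open>f' a\<close>.\<close>

lemma monotone_derivative_tendsto_at_right: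
  fixes f f' :: "real \<Rightarrow> real"
  assumes "a < b"
    and cont: "continuous_on {a..b} f"
    and der_a: "(f has_real_derivative f' a) (at_right a)"
    and der: "\<And>t. t \<in> {a<..<b} \<Longrightarrow> (f has_real_derivative f' t) (at t)"
    and mono: "mono_on {a<..<b} f'"
  shows "(f' \<longlongrightarrow> f' a) (at_right a)"
proof -
  define q where "q t = (f t - f a) / (t - a)" for t
  have q_lim: "(q \<longlongrightarrow> f' a) (at_right a)"
    using der_a unfolding has_field_derivative_iff q_def .
  \<comment> \<open>The map doubles the distance to \<open>a\<close>, so it tends to
    \<open>a\<close> while staying on the right of it, and \<open>q\<close> may be composed with
    it.\<close>
  have "((\<lambda>t. 2 * t - a) \<longlongrightarrow> 2 * a - a) (at_right a)"
    by (intro tendsto_intros)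
  then have "filterlim (\<lambda>t. 2 * t - a) (at_right a) (at_right a)"
    unfolding filterlim_at by (auto intro: eventually_mono[OF eventually_at_right_less])
  from filterlim_compose[OF q_lim this]
  have upper: "((\<lambda>t. 2 * q (2 * t - a) - q t) \<longlongrightarrow> f' a) (at_right a)"
    using q_lim by (auto intro!: tendsto_eq_intros)
  have mean_value: "\<exists>z. s < z \<and> z < t \<and> f t - f s = (t - s) * f' z"
    if "a \<le> s" "s < t" "t < b" for s t
  proof -
    have "continuous_on {s..t} f"
      using cont by (rule continuous_on_subset) (use that in auto)
    moreover have "(f has_derivative (\<lambda>h. f' z * h)) (at z)" if "s < z" "z < t" for z
      using der[of z] that \<open>a \<le> s\<close> \<open>t < b\<close> by (simp add: has_field_derivative_def)
    ultimately obtain z where "s < z" "z < t" "f t - f s = f' z * (t - s)"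
      using mvt[OF \<open>s < t\<close>, of f "\<lambda>z h. f' z * h"] by blast
    then show ?thesis by (auto simp: mult.commute)
  qed
  show ?thesis
  proof (rule tendsto_sandwich[OF _ _ q_lim upper])
    have "\<forall>\<^sub>F t in at_right a. t \<in> {a<..<b}"
      using \<open>a < b\<close> by (rule eventually_at_right_real)
    then show "\<forall>\<^sub>F t in at_right a. q t \<le> f' t"
    proof (rule eventually_mono)
      fix t assume t: "t \<in> {a<..<b}"
      obtain z where z: "a < z" "z < t" "f t - f a = (t - a) * f' z"
        using mean_value[of a t] t by auto
      have "f' z \<le> f' t" using mono_onD[OF mono, of z t] z t by simp
      then show "q t \<le> f' t" using z t by (simp add: q_def)
    qed
    \<comment> \<open>Left of the midpoint, \<open>2 * t - a\<close> stays below \<open>b\<close>,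
      so the mean value theorem applies on \<open>[t, 2 * t - a]\<close>.\<close>
    have "\<forall>\<^sub>F t in at_right a. t \<in> {a<..<(a + b) / 2}"
      using \<open>a < b\<close> by (intro eventually_at_right_real) auto
    then show "\<forall>\<^sub>F t in at_right a. f' t \<le> 2 * q (2 * t - a) - q t"
    proof (rule eventually_mono)
      fix t assume t: "t \<in> {a<..<(a + b) / 2}"
      obtain z where z: "t < z" "z < 2 * t - a" "f (2 * t - a) - f t = (t - a) * f' z"
        using mean_value[of t "2 * t - a"] t by auto
      have "f' t \<le> f' z" using mono_onD[OF mono, of t z] z t by simp
      moreover have "2 * q (2 * t - a) - q t = (f (2 * t - a) - f t) / (t - a)"
      proof -
        have "2 * q (2 * t - a) = 2 * (f (2 * t - a) - f a) / (2 * (t - a))"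
          by (simp add: q_def algebra_simps)
        also have "\<dots> = (f (2 * t - a) - f a) / (t - a)"
          by (rule mult_divide_mult_cancel_left) simp
        finally show ?thesis by (simp add: q_def diff_divide_distrib)
      qed
      ultimately show "f' t \<le> 2 * q (2 * t - a) - q t" using z t by simp
    qed
  qed
qed

text \<open>Only the endpoints need an argument. There \<open>f' a\<close> and \<open>f' b\<close>
  are one-sided derivatives of \<open>f\<close>, and they have to be identified with the one-sided
  limits of \<open>f'\<close>.\<close>

lemma continuous_on_monotone_derivative:
  fixes f f' :: "real \<Rightarrow> real"
  assumes "a < b"
    and der: "\<And>t. t \<in> {a..b} \<Longrightarrow> (f has_real_derivative f' t) (at t within {a..b})"
    and mono: "mono_on {a<..<b} f'"
    and cont: "\<And>t. t \<in> {a<..<b} \<Longrightarrow> isCont f' t"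
  shows "continuous_on {a..b} f'"
proof (rule continuous_on_IccI)
  have f_cont: "continuous_on {a..b} f"
    using der by (rule DERIV_continuous_on)
  have der_at: "(f has_real_derivative f' t) (at t)" if "t \<in> {a<..<b}" for t
    using der[of t] that at_within_Icc_at[of a t b] by simp
  show "(f' \<longlongrightarrow> f' a) (at_right a)"
    using \<open>a < b\<close> f_cont _ der_at mono
  proof (rule monotone_derivative_tendsto_at_right)
    show "(f has_real_derivative f' a) (at_right a)"
      using der[of a] \<open>a < b\<close> by (simp add: at_within_Icc_at_right)
  qed
  \<comment> \<open>The left limit at \<open>b\<close> becomes a right limit at \<open>- b\<close>
    for the mirrored function \<open>f (- t)\<close>. Its derivative \<open>- f' (- t)\<close> is
    again nondecreasing, since the reflection and the sign each reverse the order.\<close>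
  have "((\<lambda>t. - f' (- t)) \<longlongrightarrow> - f' (- (- b))) (at_right (- b))"
  proof (rule monotone_derivative_tendsto_at_right[where f = "\<lambda>t. f (- t)" and b = "- a"])
    have "(f has_real_derivative f' (- (- b))) (at (- (- b)) within uminus ` {- b<..})"
      using der[of b] \<open>a < b\<close> by (simp add: at_within_Icc_at_left)
    moreover have "(uminus has_real_derivative - 1) (at_right (- b))"
      by (auto intro!: derivative_eq_intros)
    ultimately have "(f \<circ> uminus has_real_derivative f' (- (- b)) * - 1) (at_right (- b))"
      by (rule DERIV_image_chain)
    then show "((\<lambda>t. f (- t)) has_real_derivative - f' (- (- b))) (at_right (- b))"
      by (simp add: o_def)
    show "((\<lambda>t. f (- t)) has_real_derivative - f' (- t)) (at t)" if "t \<in> {- b<..<- a}" for t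
      using der_at[of "- t"] that DERIV_mirror[of f "f' (- t)" t] by auto
    show "mono_on {- b<..<- a} (\<lambda>t. - f' (- t))"
      using mono by (auto simp: mono_on_def)
    show "continuous_on {- b..- a} (\<lambda>t. f (- t))"
      by (rule continuous_on_compose2[OF f_cont]) (auto intro!: continuous_intros)
  qed (use \<open>a < b\<close> in simp)
  then show "(f' \<longlongrightarrow> f' b) (at_left b)"
    by (auto simp: filterlim_at_left_to_right tendsto_minus_cancel_left)
  show "f' \<midarrow>t\<rightarrow> f' t" if "a < t" "t < b" for t
    using cont[of t] that by (simp add: isCont_def)
qed fact

text \<open>The supremum dominates the values only once the kernel is known to be bounded. All three
  centres lie in \<open>[a, b]\<close>, so \<open>(b - a)\<^sup>2\<close> is a bound.\<close>

lemma kernel_le_kernel_norm: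
  assumes "a \<le> \<alpha>" "\<alpha> < \<beta>" "\<beta> \<le> b" "t \<in> {a..b}"
  shows "kernel \<alpha> \<beta> x a b t \<le> kernel_norm \<alpha> \<beta> x a b"
proof -
  have "\<bar>kernel \<alpha> \<beta> x a b s\<bar> \<le> (b - a)\<^sup>2" if "s \<in> {a..b}" for s
  proof -
    have square_le: "(s - c)\<^sup>2 \<le> (b - a)\<^sup>2" if "a \<le> c" "c \<le> b" for c
    proof (rule power2_le_iff_abs_le[THEN iffD2])
      show "0 \<le> b - a" "\<bar>s - c\<bar> \<le> b - a"
        using that \<open>s \<in> {a..b}\<close> unfolding atLeastAtMost_iff by linarith+
    qed
    have "a \<le> (\<alpha> + \<beta>) / 2" "(\<alpha> + \<beta>) / 2 \<le> b"
      using assms(1-3) by (simp_all add: field_simps)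
    then have "(s - \<alpha>)\<^sup>2 \<le> (b - a)\<^sup>2" "(s - \<beta>)\<^sup>2 \<le> (b - a)\<^sup>2" "(s - (\<alpha> + \<beta>) / 2)\<^sup>2 \<le> (b - a)\<^sup>2"
      using assms(1-3) by (auto intro!: square_le)
    then show ?thesis
      unfolding kernel_def by (simp only: abs_power2 simp_thms split: if_split)
  qed
  then have "bdd_above ((\<lambda>s. \<bar>kernel \<alpha> \<beta> x a b s\<bar>) ` {a..b})"
    by (rule bdd_aboveI2)
  then have "\<bar>kernel \<alpha> \<beta> x a b t\<bar> \<le> kernel_norm \<alpha> \<beta> x a b"
    unfolding kernel_norm_def using \<open>t \<in> {a..b}\<close> by (rule cSUP_upper2) auto
  then show ?thesis by simp
qed

text \<open>The increment of \<open>G\<close> is between \<open>0\<close> and \<open>K\<close> times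
  that of \<open>f'\<close>. Derivatives are required only inside the interval; continuity carries
  both monotonicity statements to its endpoints.\<close>

lemma quadratic_weight_increment_bound:
  fixes f f' f'' F :: "real \<Rightarrow> real"
  assumes "u \<le> v"
    and "continuous_on {u..v} F" and "continuous_on {u..v} f" and "continuous_on {u..v} f'"
    and F: "\<And>t. t \<in> {u<..<v} \<Longrightarrow> (F has_real_derivative f t) (at t)"
    and f: "\<And>t. t \<in> {u<..<v} \<Longrightarrow> (f has_real_derivative f' t) (at t)"
    and f': "\<And>t. t \<in> {u<..<v} \<Longrightarrow> (f' has_real_derivative f'' t) (at t)"
    and nonneg: "\<And>t. t \<in> {u<..<v} \<Longrightarrow> 0 \<le> f'' t"
    and K: "\<And>t. t \<in> {u<..<v} \<Longrightarrow> (t - c)\<^sup>2 \<le> K"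
  defines "G \<equiv> \<lambda>t. (t - c)\<^sup>2 * f' t - 2 * (t - c) * f t + 2 * F t"
  shows "\<bar>G v - G u\<bar> \<le> K * (f' v - f' u)"
proof -
  have cont: "continuous_on {u..v} G"
    unfolding G_def using assms(2-4) by (intro continuous_intros)
  have der: "(G has_real_derivative (t - c)\<^sup>2 * f'' t) (at t)" if "t \<in> {u<..<v}" for t
    unfolding G_def
    by (rule derivative_eq_intros F[OF that] f[OF that] f'[OF that] refl)+
      (simp add: power2_eq_square algebra_simps)
  have "G u \<le> G v"
  proof (rule DERIV_nonneg_imp_increasing_open[OF \<open>u \<le> v\<close> _ cont])
    show "\<exists>y. DERIV G t :> y \<and> 0 \<le> y" if "u < t" "t < v" for t
      using der[of t] nonneg[of t] that by (intro exI[of _ "(t - c)\<^sup>2 * f'' t"]) simp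
  qed
  moreover have "K * f' u - G u \<le> K * f' v - G v"
  proof (rule DERIV_nonneg_imp_increasing_open[OF \<open>u \<le> v\<close>, of "\<lambda>t. K * f' t - G t"])
    show "\<exists>y. DERIV (\<lambda>t. K * f' t - G t) t :> y \<and> 0 \<le> y" if "u < t" "t < v" for t
    proof (intro exI conjI)
      have t: "t \<in> {u<..<v}" using that by simp
      show "DERIV (\<lambda>t. K * f' t - G t) t :> K * f'' t - (t - c)\<^sup>2 * f'' t"
        by (intro DERIV_diff DERIV_cmult f' der t)
      show "0 \<le> K * f'' t - (t - c)\<^sup>2 * f'' t"
        using mult_right_mono[OF K[OF t] nonneg[OF t]] by simp
    qed
    show "continuous_on {u..v} (\<lambda>t. K * f' t - G t)"
      using cont assms(4) by (intro continuous_intros)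
  qed
  ultimately show ?thesis by (simp add: algebra_simps)
qed

theorem theorem1:
  fixes f f' f'' :: "real \<Rightarrow> real" and I :: "real set" and a b \<alpha> \<beta> x :: real
  assumes "is_interval I" and "a \<in> I" and "b \<in> I" and "a < b"
    and "\<And>t. t \<in> interior I \<Longrightarrow> (f has_real_derivative f' t) (at t)"
    and "\<And>t. t \<in> interior I \<Longrightarrow> (f' has_real_derivative f'' t) (at t)"
    and "\<And>t. t \<in> {a..b} \<Longrightarrow> (f has_real_derivative f' t) (at t within I)"
    and "f'' absolutely_integrable_on {a..b}"
    and "a \<le> \<alpha>" and "\<alpha> < \<beta>" and "\<beta> \<le> b"
    and "convex_on {a..b} f'"
    and "\<And>t. t \<in> {a..b} \<Longrightarrow> f'' t \<ge> 0"
    and "x \<in> {a..(a + b) / 2}"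
  shows "\<bar>2 * integral {a..b} f - (\<beta> - \<alpha>) * (f x + f (a + b - x))
          + (b - \<beta>)\<^sup>2 * f' b - (a - \<alpha>)\<^sup>2 * f' a
          + 2 * (a - \<alpha>) * f a - 2 * (b - \<beta>) * f b
          + (\<beta> - \<alpha>) * ((x - (3 * \<alpha> + \<beta>) / 4) * f' x
                        + (a + b - x - (\<alpha> + 3 * \<beta>) / 4) * f' (a + b - x))\<bar>
         \<le> kernel_norm \<alpha> \<beta> x a b * (f' b - f' a)"
proof -
  define K y m where "K = kernel_norm \<alpha> \<beta> x a b" and "y = a + b - x" and "m = (\<alpha> + \<beta>) / 2"
  have sub: "{a..b} \<subseteq> I"
    using mem_is_interval_1_I[OF assms(1-3)] by auto
  have "{a<..<b} \<subseteq> interior I"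
    using interior_mono[OF sub] by simp
  then have f_der: "(f has_real_derivative f' t) (at t)"
    and f'_der: "(f' has_real_derivative f'' t) (at t)" if "t \<in> {a<..<b}" for t
    using assms(5,6) that by blast+
  have f_within: "(f has_real_derivative f' t) (at t within {a..b})" if "t \<in> {a..b}" for t
    using assms(7)[OF that] sub by (rule DERIV_subset)
  have f_cont: "continuous_on {a..b} f"
    using f_within by (rule DERIV_continuous_on)
  \<comment> \<open>The open interval is used because \<open>a\<close> and \<open>b\<close> may be
    endpoints of \<open>I\<close>, where \<open>f''\<close> is not assumed to be the derivative of
    \<open>f'\<close>.\<close>
  have mono: "mono_on {a<..<b} f'"
  proof (rule mono_onI)
    fix r s assume rs: "r \<in> {a<..<b}" "s \<in> {a<..<b}" "r \<le> s"
    show "f' r \<le> f' s"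
    proof (rule DERIV_nonneg_imp_nondecreasing[OF \<open>r \<le> s\<close>])
      show "\<exists>z. DERIV f' t :> z \<and> 0 \<le> z" if "r \<le> t" "t \<le> s" for t
        using f'_der[of t] assms(13)[of t] rs that by auto
    qed
  qed
  have f'_cont: "continuous_on {a..b} f'"
    using \<open>a < b\<close> f_within mono
  proof (rule continuous_on_monotone_derivative)
    show "isCont f' t" if "t \<in> {a<..<b}" for t
      using f'_der[OF that] by (rule DERIV_isCont)
  qed
  define F where "F t = integral {a..t} f" for t
  have F_within: "(F has_real_derivative f t) (at t within {a..b})" if "t \<in> {a..b}" for t
    unfolding F_def using f_cont that by (rule integral_has_real_derivative)
  have F_cont: "continuous_on {a..b} F"
    using F_within by (rule DERIV_continuous_on)
  have F_der: "(F has_real_derivative f t) (at t)" if "t \<in> {a<..<b}" for t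
    using F_within[of t] that by (simp add: at_within_Icc_at)
  define G where "G c t = (t - c)\<^sup>2 * f' t - 2 * (t - c) * f t + 2 * F t" for c t
  have K: "kernel \<alpha> \<beta> x a b t \<le> K" if "t \<in> {a..b}" for t
    unfolding K_def using assms(9-11) that by (rule kernel_le_kernel_norm)
  \<comment> \<open>The kernel has to agree with a single square only on the open piece, so its
    values at the jumps do not matter. The case \<open>u = v\<close> is allowed because pieces
    degenerate when \<open>x = a\<close> or \<open>x = (a + b) / 2\<close>.\<close>
  have piece: "\<bar>G c v - G c u\<bar> \<le> K * (f' v - f' u)"
    if "a \<le> u" "u \<le> v" "v \<le> b" and c: "\<And>t. t \<in> {u<..<v} \<Longrightarrow> kernel \<alpha> \<beta> x a b t = (t - c)\<^sup>2"
    for c u v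
    unfolding G_def
  proof (rule quadratic_weight_increment_bound[OF \<open>u \<le> v\<close>, where f'' = f''])
    have "{u..v} \<subseteq> {a..b}" using that by auto
    then show "continuous_on {u..v} F" "continuous_on {u..v} f" "continuous_on {u..v} f'"
      using continuous_on_subset F_cont f_cont f'_cont by blast+
    show "(t - c)\<^sup>2 \<le> K" if "t \<in> {u<..<v}" for t
      using K[of t] c[OF that] \<open>{u..v} \<subseteq> {a..b}\<close> that by (auto simp: subset_iff)
    show "(F has_real_derivative f t) (at t)" "(f has_real_derivative f' t) (at t)"
      "(f' has_real_derivative f'' t) (at t)" "0 \<le> f'' t" if "t \<in> {u<..<v}" for t
    proof -
      have t: "t \<in> {a<..<b}" using that \<open>a \<le> u\<close> \<open>v \<le> b\<close> by simp
      then show "(F has_real_derivative f t) (at t)" "(f has_real_derivative f' t) (at t)"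
        "(f' has_real_derivative f'' t) (at t)"
        by (rule F_der f_der f'_der)+
      show "0 \<le> f'' t" using t by (intro assms(13)) simp
    qed
  qed
  have x: "a \<le> x" "x \<le> y" "y \<le> b"
    using assms(14) by (auto simp: y_def field_simps)
  have "\<bar>G \<alpha> x - G \<alpha> a\<bar> \<le> K * (f' x - f' a)"
    using x by (intro piece) (auto simp: kernel_def)
  moreover have "\<bar>G m y - G m x\<bar> \<le> K * (f' y - f' x)"
    using x by (intro piece) (auto simp: kernel_def m_def y_def)
  moreover have "\<bar>G \<beta> b - G \<beta> y\<bar> \<le> K * (f' b - f' y)"
    using x by (intro piece) (auto simp: kernel_def y_def)
  ultimately have "\<bar>(G \<alpha> x - G \<alpha> a) + (G m y - G m x) + (G \<beta> b - G \<beta> y)\<bar>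
      \<le> K * (f' x - f' a) + K * (f' y - f' x) + K * (f' b - f' y)"
    by (intro abs_triangle_ineq[THEN order_trans] add_mono)
  also have "\<dots> = K * (f' b - f' a)"
    by (simp add: right_diff_distrib)
  finally have "\<bar>(G \<alpha> x - G \<alpha> a) + (G m y - G m x) + (G \<beta> b - G \<beta> y)\<bar> \<le> K * (f' b - f' a)" .
  moreover have "(G \<alpha> x - G \<alpha> a) + (G m y - G m x) + (G \<beta> b - G \<beta> y) =
      2 * integral {a..b} f - (\<beta> - \<alpha>) * (f x + f y)
      + (b - \<beta>)\<^sup>2 * f' b - (a - \<alpha>)\<^sup>2 * f' a + 2 * (a - \<alpha>) * f a - 2 * (b - \<beta>) * f b
      + (\<beta> - \<alpha>) * ((x - (3 * \<alpha> + \<beta>) / 4) * f' x + (y - (\<alpha> + 3 * \<beta>) / 4) * f' y)"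
  proof -
    \<comment> \<open>At \<open>x\<close> and \<open>y\<close> two pieces with different centres
      meet, and these identities evaluate the differences of their coefficients. The numbers
      \<open>(3 * \<alpha> + \<beta>) / 4\<close> and \<open>(\<alpha> + 3 * \<beta>) / 4\<close>
      are the midpoints of \<open>[\<alpha>, m]\<close> and \<open>[m, \<beta>]\<close>; the terms
      in \<open>F\<close> telescope.\<close>
    have "(x - \<alpha>)\<^sup>2 = (x - m)\<^sup>2 + (\<beta> - \<alpha>) * (x - (3 * \<alpha> + \<beta>) / 4)"
      and "(y - m)\<^sup>2 = (y - \<beta>)\<^sup>2 + (\<beta> - \<alpha>) * (y - (\<alpha> + 3 * \<beta>) / 4)"
      and "2 * (m - \<alpha>) = \<beta> - \<alpha>" and "2 * (\<beta> - m) = \<beta> - \<alpha>"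
      by (simp_all add: m_def power2_eq_square field_simps)
    moreover have "F a = 0" "F b = integral {a..b} f"
      by (simp_all add: F_def)
    ultimately show ?thesis
      unfolding G_def by algebra
  qed
  ultimately show ?thesis
    unfolding K_def y_def by (simp only:)
qed

end
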